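(* Let $(\mathcal{X},d)$ be a standard $\mathcal{R}$-metric space, let $S$ be a submonoid of $\mathrm{IE}(\mathcal{X})$ closed with respect to $\tau_{mpw}$, and let $\mathcal{T}$ be a submonoid of $\mathcal{R}$ dense with respect to the order. Suppose $S$ is pinching and spreading with respect to $\mathcal{T}$. Let $a,b\in X$, $\epsilon\in T\setminus\{0\}$ and $s_0\in W_{(a,b,\epsilon)}$. Then there is some $\mathcal{V}$ open in the semigroup Zariski topology $\tau_Z$ on $S$ with $s_0\in\mathcal{V}\subseteq W_{(a,b,\epsilon)}$. In particular $\tau_{mpw}=\tau_Z$ on $S$, and $\tau_{mpw}$ is minimal amongst Hausdorff semigroup topologies on $S$.
   Context: A distance monoid $\mathcal{R}=(R,\le,\oplus,0)$ is a commutative monoid with total order such that $r\le r\oplus s$ and $s\le s'\Rightarrow s\oplus t\le s'\oplus t$; it is standard if whenever $0\ne r$ and $s<r$ there is $0\ne t$ with $s\oplus t<r$. An $\mathcal{R}$-metric space $(\mathcal{X},d)$ has $d:X^2\to R$ with $d(x,y)=0\iff x=y$, symmetry and $d(x,z)\le d(x,y)\oplus d(y,z)$; it is standard if $\mathcal{R}$ is. $\mathrm{IE}(\mathcal{X})$ is the monoid of isometric self-embeddings. $B_\epsilon(a)=\{b:d(a,b)<\epsilon\}$, and for $Y\subseteq X$, $B_\epsilon(Y)=\bigcup_{y\in Y}B_\epsilon(y)$. $\tau_{mpw}$ is the restriction to $\mathrm{IE}(\mathcal{X})$ of the product topology on $X^X$ where $X$ has the topology with basis the balls $B_\epsilon(a)$,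 $\epsilon\in R\setminus\{0\}$; it is generated by the sets $W_{(a,b,\epsilon)}=\{s: s(a)\in B_\epsilon(b)\}$. $S$ is pinching w.r.t. $\mathcal{T}$ if for every sufficiently small $\epsilon\in T\setminus\{0\}$ and every $a\in X$ there are $\phi,\psi\in S$ agreeing on $X\setminus B_\epsilon(a)$ with $\phi(b)\ne\psi(b)$ for all $b\in B_\epsilon(a)$. $S$ is spreading w.r.t. $\mathcal{T}$ if for every sufficiently small $\epsilon\in T\setminus\{0\}$ and every $a\in X$ there are $\sigma,\theta\in S$ with $a\in\mathrm{im}(\sigma)\cap\mathrm{im}(\theta)$ and $\mathrm{im}(\sigma)\cap B_\epsilon(\mathrm{im}(\theta))\subseteq B_\epsilon(a)$. $\tau_Z$ on $S$ is generated by solution sets of inequalities $\lambda_ns\cdots\lambda_1s\lambda_0\ne\eta_ms\cdots\eta_1s\eta_0$ with parameters in $S$. *)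

theory Defs
  imports "HOL-Analysis.Analysis"
begin

class distance_monoid = linorder + ordered_comm_monoid_add +
  assumes le_add_right_self: "r \<le> r + s"

class standard_distance_monoid = distance_monoid +
  assumes standard: "r \<noteq> 0 \<Longrightarrow> s < r \<Longrightarrow> \<exists>t. t \<noteq> 0 \<and> s + t < r"

definition submonoid_R :: "'r::distance_monoid set \<Rightarrow> bool" where
  "submonoid_R T \<longleftrightarrow> 0 \<in> T \<and> (\<forall>s\<in>T. \<forall>t\<in>T. s + t \<in> T)"

(* Density in the order topology, generated by the open rays as in the class linorder_topology.
   For orders with jumps this is weaker than requiring a point of T strictly between any two
   points; in particular UNIV is always dense. *)
definition order_dense :: "'r::linorder set \<Rightarrow> bool" where
  "order_dense T \<longleftrightarrow>
     (\<forall>U. generate_topology (range lessThan \<union> range greaterThan) U \<and> U \<noteq> {} \<longrightarrow> U \<inter> T \<noteq> {})"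

definition monoid_metric :: "('x \<Rightarrow> 'x \<Rightarrow> 'r::distance_monoid) \<Rightarrow> bool" where
  "monoid_metric d \<longleftrightarrow>
     (\<forall>x y. d x y = 0 \<longleftrightarrow> x = y) \<and>
     (\<forall>x y. d x y = d y x) \<and>
     (\<forall>x y z. d x z \<le> d x y + d y z)"

definition dball :: "('x \<Rightarrow> 'x \<Rightarrow> 'r::distance_monoid) \<Rightarrow> 'r \<Rightarrow> 'x \<Rightarrow> 'x set" where
  "dball d \<epsilon> a = {b. d a b < \<epsilon>}"

definition dball_set :: "('x \<Rightarrow> 'x \<Rightarrow> 'r::distance_monoid) \<Rightarrow> 'r \<Rightarrow> 'x set \<Rightarrow> 'x set" where
  "dball_set d \<epsilon> Y = (\<Union>y\<in>Y. dball d \<epsilon> y)"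

definition IE :: "('x \<Rightarrow> 'x \<Rightarrow> 'r::distance_monoid) \<Rightarrow> ('x \<Rightarrow> 'x) set" where
  "IE d = {f. \<forall>x y. d (f x) (f y) = d x y}"

definition submonoid_IE :: "('x \<Rightarrow> 'x \<Rightarrow> 'r::distance_monoid) \<Rightarrow> ('x \<Rightarrow> 'x) set \<Rightarrow> bool" where
  "submonoid_IE d S \<longleftrightarrow> S \<subseteq> IE d \<and> id \<in> S \<and> (\<forall>f\<in>S. \<forall>g\<in>S. f \<circ> g \<in> S)"

definition dball_topology :: "('x \<Rightarrow> 'x \<Rightarrow> 'r::distance_monoid) \<Rightarrow> 'x topology" where
  "dball_topology d = topology_generated_by {dball d \<epsilon> a |\<epsilon> a. \<epsilon> \<noteq> 0}"

definition mpw_topology :: "('x \<Rightarrow> 'x \<Rightarrow> 'r::distance_monoid) \<Rightarrow> ('x \<Rightarrow> 'x) topology" where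
  "mpw_topology d = subtopology (product_topology (\<lambda>_. dball_topology d) UNIV) (IE d)"

definition W :: "('x \<Rightarrow> 'x \<Rightarrow> 'r::distance_monoid) \<Rightarrow> 'x \<Rightarrow> 'x \<Rightarrow> 'r \<Rightarrow> ('x \<Rightarrow> 'x) set" where
  "W d a b \<epsilon> = {s \<in> IE d. s a \<in> dball d \<epsilon> b}"

definition pinching ::
  "('x \<Rightarrow> 'x \<Rightarrow> 'r::distance_monoid) \<Rightarrow> 'r set \<Rightarrow> ('x \<Rightarrow> 'x) set \<Rightarrow> bool" where
  "pinching d T S \<longleftrightarrow>
     (\<exists>\<epsilon>\<^sub>0\<in>T - {0}. \<forall>\<epsilon>\<in>T - {0}. \<epsilon> \<le> \<epsilon>\<^sub>0 \<longrightarrow>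
        (\<forall>a. \<exists>\<phi>\<in>S. \<exists>\<psi>\<in>S.
           (\<forall>x. x \<notin> dball d \<epsilon> a \<longrightarrow> \<phi> x = \<psi> x) \<and>
           (\<forall>b\<in>dball d \<epsilon> a. \<phi> b \<noteq> \<psi> b)))"

definition spreading ::
  "('x \<Rightarrow> 'x \<Rightarrow> 'r::distance_monoid) \<Rightarrow> 'r set \<Rightarrow> ('x \<Rightarrow> 'x) set \<Rightarrow> bool" where
  "spreading d T S \<longleftrightarrow>
     (\<exists>\<epsilon>\<^sub>0\<in>T - {0}. \<forall>\<epsilon>\<in>T - {0}. \<epsilon> \<le> \<epsilon>\<^sub>0 \<longrightarrow>
        (\<forall>a. \<exists>\<sigma>\<in>S. \<exists>\<theta>\<in>S.
           a \<in> range \<sigma> \<inter> range \<theta> \<and>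
           range \<sigma> \<inter> dball_set d \<epsilon> (range \<theta>) \<subseteq> dball d \<epsilon> a))"

(* zariski_word l0 [l1, ..., ln] s = ln s ... l1 s l0 *)
definition zariski_word :: "('x \<Rightarrow> 'x) \<Rightarrow> ('x \<Rightarrow> 'x) list \<Rightarrow> ('x \<Rightarrow> 'x) \<Rightarrow> ('x \<Rightarrow> 'x)" where
  "zariski_word l0 ls s = foldl (\<lambda>w l. l \<circ> s \<circ> w) l0 ls"

(* S itself is added to the generators because the space of topology_generated_by is the union of
   the generators, which would be empty for a one-element S. *)
definition zariski_topology :: "('x \<Rightarrow> 'x) set \<Rightarrow> ('x \<Rightarrow> 'x) topology" where
  "zariski_topology S = topology_generated_by (insert S
     {{s \<in> S. zariski_word l0 ls s \<noteq> zariski_word e0 es s} |l0 ls e0 es.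
        l0 \<in> S \<and> set ls \<subseteq> S \<and> e0 \<in> S \<and> set es \<subseteq> S})"

definition hausdorff_semigroup_topology ::
  "('x \<Rightarrow> 'x) set \<Rightarrow> ('x \<Rightarrow> 'x) topology \<Rightarrow> bool" where
  "hausdorff_semigroup_topology S \<tau> \<longleftrightarrow>
     topspace \<tau> = S \<and> Hausdorff_space \<tau> \<and>
     continuous_map (prod_topology \<tau> \<tau>) \<tau> (\<lambda>(f, g). f \<circ> g)"

definition minimal_hausdorff_semigroup_topology ::
  "('x \<Rightarrow> 'x) set \<Rightarrow> ('x \<Rightarrow> 'x) topology \<Rightarrow> bool" where
  "minimal_hausdorff_semigroup_topology S \<tau> \<longleftrightarrow>
     hausdorff_semigroup_topology S \<tau> \<and>
     (\<forall>\<tau>'. hausdorff_semigroup_topology S \<tau>' \<and> (\<forall>U. openin \<tau>' U \<longrightarrow> openin \<tau> U) \<longrightarrow> \<tau>' = \<tau>)"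

end

(*
  Let c = s0 a. If phi and psi differ exactly on the ball of radius t around c, then
  phi s sigma ~= psi s sigma says that s moves some point y of the range of sigma into that ball.
  Imposing this for both maps sigma, theta of a spreading pair at a yields points y and z of
  their ranges that s moves near c; as s is isometric, y and z are close, so spreading forces y,
  and hence s a near s y, to be close to a and c respectively. Thus each W(a,b,eps) is a Zariski
  neighbourhood of each of its points in S, while the Zariski topology is coarser than every
  Hausdorff semigroup topology, in particular than the one of pointwise convergence.
*)
theory Submission
  imports Defs
begin

section \<open>Small distances\<close>

lemma distance_nonneg: "(0::'r::distance_monoid) \<le> r"
  using le_add_right_self[of 0 r] by simp

lemma distance_pos_iff: "(0::'r::distance_monoid) < r \<longleftrightarrow> r \<noteq> 0"
  using distance_nonneg[of r] by auto

text \<open>This replaces the passage to half of epsilon, as elements of the monoid cannot be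
  halved. Standardness fits \<open>u\<close> between \<open>s\<close> and \<open>r\<close>, then
  splits \<open>u\<close> into nonzero \<open>v\<close> and \<open>w\<close>; the smaller of these
  can be doubled.\<close>

lemma standard_two_halves:
  fixes r s :: "'r::standard_distance_monoid"
  assumes "s < r"
  obtains t where "t \<noteq> 0" "s + (t + t) < r"
proof -
  have "r \<noteq> 0"
    using assms distance_nonneg[of s] by auto
  then obtain u where u: "u \<noteq> 0" "s + u < r"
    using standard assms by blast
  obtain v where v: "v \<noteq> 0" "v < u"
    using standard[of u 0] u(1) distance_pos_iff by auto
  obtain w where w: "w \<noteq> 0" "v + w < u"
    using standard[OF u(1) v(2)] by blast
  have "min v w + min v w \<le> v + w"
    by (intro add_mono) auto
  also have "\<dots> \<le> u"
    using w by simp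
  finally have "s + (min v w + min v w) \<le> s + u"
    by (rule add_left_mono)
  with u v w show thesis
    by (intro that[of "min v w"]) (auto simp: min_def)
qed

text \<open>Density yields points of \<open>T\<close> only in nonempty open sets, so standardness
  first supplies an element strictly between 0 and \<open>r\<close>.\<close>

lemma order_dense_small:
  fixes r :: "'r::standard_distance_monoid"
  assumes "order_dense T" "r \<noteq> 0"
  obtains t where "t \<in> T" "t \<noteq> 0" "t < r"
proof -
  obtain u where "u \<noteq> 0" "u < r"
    using standard[of r 0] assms(2) distance_pos_iff by auto
  then have "u \<in> {0<..} \<inter> {..<r}"
    using distance_pos_iff by auto
  moreover have "generate_topology (range lessThan \<union> range greaterThan) ({0<..} \<inter> {..<r})"
    by (intro generate_topology.Int generate_topology.Basis) auto
  ultimately obtain t where "t \<in> T" "0 < t" "t < r"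
    using assms(1) unfolding order_dense_def by blast
  then show thesis
    using that by auto
qed

section \<open>The topology of pointwise convergence\<close>

lemma monoid_metricD:
  assumes "monoid_metric d"
  shows "d x x = 0" "d x y = 0 \<longleftrightarrow> x = y" "d x y = d y x" "d x z \<le> d x y + d y z"
  using assms unfolding monoid_metric_def by blast+

lemma openin_dball: "\<epsilon> \<noteq> 0 \<Longrightarrow> openin (dball_topology d) (dball d \<epsilon> a)"
  unfolding dball_topology_def by (intro topology_generated_by_Basis) blast

lemma centre_in_dball: "monoid_metric d \<Longrightarrow> \<epsilon> \<noteq> 0 \<Longrightarrow> a \<in> dball d \<epsilon> a"
  by (simp add: dball_def monoid_metricD(1) distance_pos_iff)

text \<open>The witness \<open>e\<close> excludes the trivial monoid, over which there are no balls
  of nonzero radius and the generated topology has empty carrier.\<close>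

lemma topspace_dball_topology:
  fixes d :: "'x \<Rightarrow> 'x \<Rightarrow> 'r::distance_monoid"
  assumes "monoid_metric d" "(e::'r) \<noteq> 0"
  shows "topspace (dball_topology d) = UNIV"
proof (rule UNIV_eq_I[symmetric])
  show "x \<in> topspace (dball_topology d)" for x
    using centre_in_dball[OF assms] by (rule subsetD[OF openin_subset[OF openin_dball[OF assms(2)]]])
qed

lemma Hausdorff_dball_topology:
  fixes d :: "'x \<Rightarrow> 'x \<Rightarrow> 'r::standard_distance_monoid"
  assumes "monoid_metric d"
  shows "Hausdorff_space (dball_topology d)"
  unfolding Hausdorff_space_def
proof (intro allI impI)
  fix x y assume "x \<in> topspace (dball_topology d) \<and> y \<in> topspace (dball_topology d) \<and> x \<noteq> y"
  then have "0 < d x y"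
    using monoid_metricD(2)[OF assms] distance_pos_iff by blast
  then obtain t where t: "t \<noteq> 0" "t + t < d x y"
    using standard_two_halves by (metis add_0)
  have "disjnt (dball d t x) (dball d t y)"
    unfolding disjnt_iff
  proof (intro allI notI)
    fix z assume "z \<in> dball d t x \<and> z \<in> dball d t y"
    then have "d x z + d z y \<le> t + t"
      using monoid_metricD(3)[OF assms, of z y] by (intro add_mono) (auto simp: dball_def)
    with t(2) monoid_metricD(4)[OF assms, where x = x and y = z and z = y] show False
      by auto
  qed
  then show "\<exists>U V. openin (dball_topology d) U \<and> openin (dball_topology d) V \<and>
      x \<in> U \<and> y \<in> V \<and> disjnt U V"
    by (intro exI[of _ "dball d t x"] exI[of _ "dball d t y"])
      (simp add: openin_dball centre_in_dball assms t(1))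
qed

lemma subtopology_mpw_topology:
  "S \<subseteq> IE d \<Longrightarrow> subtopology (mpw_topology d) S =
     subtopology (product_topology (\<lambda>_. dball_topology d) UNIV) S"
  by (simp add: mpw_topology_def subtopology_subtopology Int_absorb1)

lemma topspace_subtopology_mpw_topology:
  fixes d :: "'x \<Rightarrow> 'x \<Rightarrow> 'r::distance_monoid"
  assumes "monoid_metric d" "(e::'r) \<noteq> 0" "S \<subseteq> IE d"
  shows "topspace (subtopology (mpw_topology d) S) = S"
  using assms by (simp add: subtopology_mpw_topology topspace_dball_topology[OF assms(1,2)])

text \<open>Preimages of balls under evaluations suffice because these sets generate the topology.
  With \<open>Z\<close> arbitrary, the criterion serves for composition as well as for identity maps
  between topologies on \<open>S\<close>.\<close>

lemma continuous_map_into_mpw_topology: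
  fixes d :: "'x \<Rightarrow> 'x \<Rightarrow> 'r::distance_monoid"
  assumes "monoid_metric d" "(e::'r) \<noteq> 0" "S \<subseteq> IE d"
  shows "continuous_map Z (subtopology (mpw_topology d) S) f \<longleftrightarrow>
    f \<in> topspace Z \<rightarrow> S \<and>
    (\<forall>a b \<epsilon>. \<epsilon> \<noteq> 0 \<longrightarrow> openin Z {z \<in> topspace Z. f z a \<in> dball d \<epsilon> b})"
proof -
  have "continuous_map Z (dball_topology d) g \<longleftrightarrow>
      (\<forall>b \<epsilon>. \<epsilon> \<noteq> 0 \<longrightarrow> openin Z {z \<in> topspace Z. g z \<in> dball d \<epsilon> b})" (is "_ \<longleftrightarrow> ?R") for g
  proof
    assume "continuous_map Z (dball_topology d) g"
    then show ?R
      by (simp add: openin_continuous_map_preimage openin_dball)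
  next
    assume R: ?R
    show "continuous_map Z (dball_topology d) g"
      unfolding dball_topology_def
    proof (rule continuous_on_generated_topo)
      fix U assume "U \<in> {dball d \<epsilon> a |\<epsilon> a. \<epsilon> \<noteq> 0}"
      then obtain \<epsilon> a where "\<epsilon> \<noteq> 0" "U = dball d \<epsilon> a"
        by blast
      moreover have "g -` U \<inter> topspace Z = {z \<in> topspace Z. g z \<in> U}"
        by auto
      ultimately show "openin Z (g -` U \<inter> topspace Z)"
        using R by simp
    next
      show "g ` topspace Z \<subseteq> \<Union> {dball d \<epsilon> a |\<epsilon> a. \<epsilon> \<noteq> 0}"
        using centre_in_dball[OF assms(1,2)] assms(2) by blast
    qed
  qed
  then show ?thesis
    by (auto simp: subtopology_mpw_topology[OF assms(3)] continuous_map_in_subtopology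
        continuous_map_componentwise_UNIV)
qed

text \<open>Joint continuity of composition rests on isometry: if \<open>p\<close> is close to
  \<open>f\<close> at \<open>g a\<close> and \<open>q\<close> is close to \<open>g\<close> at
  \<open>a\<close>, then \<open>p (q a)\<close> is close to \<open>p (g a)\<close>, hence to
  \<open>f (g a)\<close>.\<close>

lemma hausdorff_semigroup_mpw_topology:
  fixes d :: "'x \<Rightarrow> 'x \<Rightarrow> 'r::standard_distance_monoid"
  assumes d: "monoid_metric d" and e: "(e::'r) \<noteq> 0" and S: "submonoid_IE d S"
  shows "hausdorff_semigroup_topology S (subtopology (mpw_topology d) S)"
proof -
  let ?M = "subtopology (mpw_topology d) S"
  have SIE: "S \<subseteq> IE d" and comp: "\<And>f g. f \<in> S \<Longrightarrow> g \<in> S \<Longrightarrow> f \<circ> g \<in> S"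
    using S by (auto simp: submonoid_IE_def)
  note top = topspace_subtopology_mpw_topology[OF d e SIE]
  have eval: "openin ?M {s \<in> S. s a \<in> dball d \<epsilon> b}" if "\<epsilon> \<noteq> 0" for a b \<epsilon>
  proof -
    \<comment> \<open>Applied to the identity, the continuity criterion says precisely that the
      evaluation sets are open.\<close>
    have "continuous_map ?M ?M (\<lambda>s. s)"
      by simp
    with that show ?thesis
      unfolding continuous_map_into_mpw_topology[OF d e SIE] top by blast
  qed
  have "continuous_map (prod_topology ?M ?M) ?M (\<lambda>(f, g). f \<circ> g)"
    unfolding continuous_map_into_mpw_topology[OF d e SIE] topspace_prod_topology top
  proof (intro conjI allI impI)
    show "(\<lambda>(f, g). f \<circ> g) \<in> S \<times> S \<rightarrow> S"
      using comp by auto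
  next
    fix a b and \<epsilon> :: 'r
    assume "\<epsilon> \<noteq> 0"
    let ?P = "{z \<in> S \<times> S. (case z of (f, g) \<Rightarrow> f \<circ> g) a \<in> dball d \<epsilon> b}"
    show "openin (prod_topology ?M ?M) ?P"
    proof (subst openin_subopen, intro ballI)
      fix z assume z: "z \<in> ?P"
      obtain f g where [simp]: "z = (f, g)" by fastforce
      have fg: "f \<in> S" "g \<in> S" "d b (f (g a)) < \<epsilon>"
        using z by (auto simp: dball_def)
      obtain t where t: "t \<noteq> 0" "d b (f (g a)) + (t + t) < \<epsilon>"
        using standard_two_halves fg(3) by blast
      let ?U = "{s \<in> S. s (g a) \<in> dball d t (f (g a))}"
      let ?V = "{s \<in> S. s a \<in> dball d t (g a)}"
      have "?U \<times> ?V \<subseteq> ?P"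
      proof clarsimp
        fix p q
        assume p: "p \<in> S" "p (g a) \<in> dball d t (f (g a))"
          and q: "q \<in> S" "q a \<in> dball d t (g a)"
        \<comment> \<open>The bound on \<open>q a\<close> passes through \<open>p\<close> without
          loss, whichever \<open>p\<close> was chosen.\<close>
        have "d (p (g a)) (p (q a)) = d (g a) (q a)"
          using p(1) SIE by (auto simp: IE_def)
        then have le: "d (f (g a)) (p (g a)) + d (p (g a)) (p (q a)) \<le> t + t"
          using p(2) q(2) by (intro add_mono) (auto simp: dball_def)
        have "d b (p (q a)) \<le> d b (f (g a)) + d (f (g a)) (p (q a))"
          by (rule monoid_metricD(4)[OF d])
        also have "\<dots> \<le> d b (f (g a)) + (t + t)"
          using order_trans[OF monoid_metricD(4)[OF d] le] by (intro add_left_mono)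
        finally show "p (q a) \<in> dball d \<epsilon> b"
          using t(2) by (simp add: dball_def)
      qed
      moreover have "openin (prod_topology ?M ?M) (?U \<times> ?V)"
        using eval[OF t(1)] by (simp add: openin_prod_Times_iff)
      moreover have "z \<in> ?U \<times> ?V"
        using fg centre_in_dball[OF d t(1)] by simp
      ultimately show "\<exists>N. openin (prod_topology ?M ?M) N \<and> z \<in> N \<and> N \<subseteq> ?P"
        by blast
    qed
  qed
  moreover have "Hausdorff_space ?M"
    unfolding subtopology_mpw_topology[OF SIE]
    by (intro Hausdorff_space_subtopology)
      (simp add: Hausdorff_space_product_topology Hausdorff_dball_topology[OF d])
  ultimately show ?thesis
    unfolding hausdorff_semigroup_topology_def using top by blast
qed

section \<open>The Zariski topology\<close>

lemma topspace_zariski_topology: "topspace (zariski_topology S) = S"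
  by (auto simp: zariski_topology_def)

text \<open>These are inequalities with a single occurrence of \<open>s\<close> on each side and a
  common right factor.\<close>

lemma zariski_open_inequality:
  assumes "\<phi> \<in> S" "\<psi> \<in> S" "\<sigma> \<in> S"
  shows "openin (zariski_topology S) {s \<in> S. \<phi> \<circ> s \<circ> \<sigma> \<noteq> \<psi> \<circ> s \<circ> \<sigma>}"
  unfolding zariski_topology_def
proof (rule topology_generated_by_Basis, rule insertI2, rule CollectI, intro exI conjI)
  show "{s \<in> S. \<phi> \<circ> s \<circ> \<sigma> \<noteq> \<psi> \<circ> s \<circ> \<sigma>} =
      {s \<in> S. zariski_word \<sigma> [\<phi>] s \<noteq> zariski_word \<sigma> [\<psi>] s}"
    by (simp add: zariski_word_def)
qed (use assms in auto)

text \<open>Each further letter is one more composition of continuous maps. The induction runs from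
  the end of the list because the last letter is the outermost factor.\<close>

lemma continuous_map_zariski_word:
  assumes \<tau>: "hausdorff_semigroup_topology S \<tau>" and "l0 \<in> S" "set ls \<subseteq> S"
  shows "continuous_map \<tau> \<tau> (zariski_word l0 ls)"
  using assms(3)
proof (induction ls rule: rev_induct)
  case Nil
  then show ?case
    using \<tau> \<open>l0 \<in> S\<close> by (simp add: zariski_word_def hausdorff_semigroup_topology_def)
next
  case (snoc l ls)
  have comp: "continuous_map \<tau> \<tau> (\<lambda>s. f s \<circ> g s)"
    if "continuous_map \<tau> \<tau> f" "continuous_map \<tau> \<tau> g" for f g
    using continuous_map_compose[OF continuous_map_pairedI[OF that]] \<tau>
    by (fastforce simp: hausdorff_semigroup_topology_def o_def)
  have "continuous_map \<tau> \<tau> (\<lambda>s. l)"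
    using snoc.prems \<tau> by (simp add: hausdorff_semigroup_topology_def)
  then have "continuous_map \<tau> \<tau> (\<lambda>s. l \<circ> s \<circ> zariski_word l0 ls s)"
    using snoc by (intro comp) auto
  moreover have "zariski_word l0 (ls @ [l]) = (\<lambda>s. l \<circ> s \<circ> zariski_word l0 ls s)"
    by (rule ext) (simp add: zariski_word_def)
  ultimately show ?case
    by metis
qed

text \<open>Two continuous maps into a Hausdorff space agree on a closed set, so every generating
  inequality defines an open set of \<open>\<tau>\<close>.\<close>

lemma zariski_topology_coarsest:
  assumes \<tau>: "hausdorff_semigroup_topology S \<tau>" and "openin (zariski_topology S) U"
  shows "openin \<tau> U"
proof -
  have S: "topspace \<tau> = S" and H: "Hausdorff_space \<tau>"
    using \<tau> by (auto simp: hausdorff_semigroup_topology_def)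
  have word: "openin \<tau> {s \<in> S. zariski_word l0 ls s \<noteq> zariski_word e0 es s}"
    if "l0 \<in> S" "set ls \<subseteq> S" "e0 \<in> S" "set es \<subseteq> S" for l0 ls e0 es
  proof -
    have "closedin \<tau> {s \<in> topspace \<tau>. zariski_word l0 ls s = zariski_word e0 es s}"
      using that by (intro closedin_continuous_maps_eq[OF H] continuous_map_zariski_word[OF \<tau>])
    then have "openin \<tau> (topspace \<tau> - {s \<in> topspace \<tau>. zariski_word l0 ls s = zariski_word e0 es s})"
      by blast
    moreover have "topspace \<tau> - {s \<in> topspace \<tau>. zariski_word l0 ls s = zariski_word e0 es s} =
        {s \<in> S. zariski_word l0 ls s \<noteq> zariski_word e0 es s}"
      using S by auto
    ultimately show ?thesis
      by simp
  qed
  \<comment> \<open>Continuity of the identity carries openness from the generators to all Zariski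
    open sets.\<close>
  have "continuous_map \<tau> (zariski_topology S) (\<lambda>s. s)"
    unfolding zariski_topology_def
  proof (rule continuous_on_generated_topo)
    fix U
    assume "U \<in> insert S {{s \<in> S. zariski_word l0 ls s \<noteq> zariski_word e0 es s} |l0 ls e0 es.
        l0 \<in> S \<and> set ls \<subseteq> S \<and> e0 \<in> S \<and> set es \<subseteq> S}"
    then have "openin \<tau> U"
      using word S by auto
    then show "openin \<tau> ((\<lambda>s. s) -` U \<inter> topspace \<tau>)"
      by (simp add: openin_Int)
  qed (use S in auto)
  then have "openin \<tau> {s \<in> topspace \<tau>. s \<in> U}"
    using assms(2) by (rule openin_continuous_map_preimage)
  moreover have "{s \<in> topspace \<tau>. s \<in> U} = U"
    using openin_subset[OF assms(2)] by (auto simp: S topspace_zariski_topology)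
  ultimately show ?thesis
    by simp
qed

text \<open>The radius \<open>\<epsilon>\<close> ranges over the whole monoid, as the comparison of
  topologies requires; density of \<open>T\<close> is what supplies the radii \<open>t\<close> for
  pinching and \<open>r\<close> for spreading.\<close>

lemma zariski_neighbourhood_in_W:
  fixes d :: "'x \<Rightarrow> 'x \<Rightarrow> 'r::standard_distance_monoid"
  assumes d: "monoid_metric d" and SIE: "S \<subseteq> IE d" and T: "order_dense T"
    and "pinching d T S" "spreading d T S" and s\<^sub>0: "s\<^sub>0 \<in> S" "s\<^sub>0 a \<in> dball d \<epsilon> b"
  shows "\<exists>V. openin (zariski_topology S) V \<and> s\<^sub>0 \<in> V \<and> V \<subseteq> W d a b \<epsilon>"
proof -
  define c where "c = s\<^sub>0 a"
  have "d b c < \<epsilon>"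
    using s\<^sub>0(2) by (simp add: dball_def c_def)
  \<comment> \<open>One \<open>u\<close> pays for the distance from \<open>c\<close> to
    \<open>s y\<close>, the other for that from \<open>s y\<close> to \<open>s a\<close>.\<close>
  then obtain u where u: "u \<noteq> 0" "d b c + (u + u) < \<epsilon>"
    using standard_two_halves by blast
  obtain \<epsilon>1 where \<epsilon>1: "\<epsilon>1 \<noteq> 0" "\<And>\<epsilon> a. \<epsilon> \<in> T - {0} \<Longrightarrow> \<epsilon> \<le> \<epsilon>1 \<Longrightarrow> \<exists>\<phi>\<in>S. \<exists>\<psi>\<in>S.
      (\<forall>x. x \<notin> dball d \<epsilon> a \<longrightarrow> \<phi> x = \<psi> x) \<and> (\<forall>b\<in>dball d \<epsilon> a. \<phi> b \<noteq> \<psi> b)"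
    using assms(4) unfolding pinching_def by blast
  obtain \<epsilon>2 where \<epsilon>2: "\<epsilon>2 \<noteq> 0" "\<And>\<epsilon> a. \<epsilon> \<in> T - {0} \<Longrightarrow> \<epsilon> \<le> \<epsilon>2 \<Longrightarrow> \<exists>\<sigma>\<in>S. \<exists>\<theta>\<in>S.
      a \<in> range \<sigma> \<inter> range \<theta> \<and> range \<sigma> \<inter> dball_set d \<epsilon> (range \<theta>) \<subseteq> dball d \<epsilon> a"
    using assms(5) unfolding spreading_def by blast
  have "min u \<epsilon>2 \<noteq> 0"
    using u(1) \<epsilon>2(1) by (simp add: min_def)
  then obtain r where r: "r \<in> T" "r \<noteq> 0" "r < min u \<epsilon>2"
    using order_dense_small[OF T] by blast
  \<comment> \<open>The pinching radius \<open>t\<close> will lie below \<open>v\<close>, so two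
    points within \<open>t\<close> of \<open>c\<close> are less than \<open>r\<close> apart, as
    spreading at radius \<open>r\<close> demands.\<close>
  obtain v where v: "v \<noteq> 0" "v + v < r"
    using standard_two_halves r(2) distance_pos_iff by (metis add_0)
  have "min v (min \<epsilon>1 u) \<noteq> 0"
    using v(1) \<epsilon>1(1) u(1) by (simp add: min_def)
  then obtain t where t: "t \<in> T" "t \<noteq> 0" "t < min v (min \<epsilon>1 u)"
    using order_dense_small[OF T] by blast
  have t': "t \<in> T - {0}" "t \<le> \<epsilon>1"
    using t by auto
  obtain \<phi> \<psi> where \<phi>\<psi>: "\<phi> \<in> S" "\<psi> \<in> S" "\<And>x. x \<notin> dball d t c \<Longrightarrow> \<phi> x = \<psi> x"
      "\<And>x. x \<in> dball d t c \<Longrightarrow> \<phi> x \<noteq> \<psi> x"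
    using \<epsilon>1(2)[OF t', of c] by blast
  have r': "r \<in> T - {0}" "r \<le> \<epsilon>2"
    using r by auto
  obtain \<sigma> \<theta> where \<sigma>\<theta>: "\<sigma> \<in> S" "\<theta> \<in> S" "a \<in> range \<sigma>" "a \<in> range \<theta>"
      "range \<sigma> \<inter> dball_set d r (range \<theta>) \<subseteq> dball d r a"
    using \<epsilon>2(2)[OF r', of a] by blast
  have detect: "\<phi> \<circ> s \<circ> \<rho> \<noteq> \<psi> \<circ> s \<circ> \<rho> \<longleftrightarrow> (\<exists>y\<in>range \<rho>. s y \<in> dball d t c)" for s \<rho>
    using \<phi>\<psi>(3,4) by (auto simp: fun_eq_iff)
  let ?V = "{s \<in> S. \<phi> \<circ> s \<circ> \<sigma> \<noteq> \<psi> \<circ> s \<circ> \<sigma>} \<inter> {s \<in> S. \<phi> \<circ> s \<circ> \<theta> \<noteq> \<psi> \<circ> s \<circ> \<theta>}"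
  have "openin (zariski_topology S) ?V"
    using \<phi>\<psi> \<sigma>\<theta> by (intro openin_Int zariski_open_inequality)
  \<comment> \<open>The point \<open>a\<close> lies in both ranges and \<open>s\<^sub>0\<close>
    sends it to the centre \<open>c\<close>, so it witnesses both inequalities.\<close>
  moreover have "s\<^sub>0 \<in> ?V"
    unfolding detect
    using s\<^sub>0(1) \<sigma>\<theta>(3,4) centre_in_dball[OF d t(2), of c] c_def by blast
  moreover have "?V \<subseteq> W d a b \<epsilon>"
  proof
    fix s assume "s \<in> ?V"
    then obtain y z where s: "s \<in> S" and y: "y \<in> range \<sigma>" "d c (s y) < t"
      and z: "z \<in> range \<theta>" "d c (s z) < t"
      unfolding detect by (auto simp: dball_def)
    have iso: "d (s p) (s q) = d p q" for p q
      using s SIE by (auto simp: IE_def)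
    \<comment> \<open>Isometry pulls the closeness of the images near \<open>c\<close> back to
      \<open>y\<close> and \<open>z\<close>.\<close>
    have "d z y = d (s z) (s y)"
      by (simp add: iso)
    also have "\<dots> \<le> d (s z) c + d c (s y)"
      by (rule monoid_metricD(4)[OF d])
    also have "\<dots> \<le> v + v"
      using y(2) z(2) t(3) monoid_metricD(3)[OF d, of "s z" c] by (intro add_mono) auto
    finally have "y \<in> dball_set d r (range \<theta>)"
      using v(2) z(1) unfolding dball_set_def dball_def by (blast intro: le_less_trans)
    with \<sigma>\<theta>(5) y(1) have "d a y < r"
      by (auto simp: dball_def)
    \<comment> \<open>Isometry is now used forwards, to carry the bound given by spreading to the
      images under \<open>s\<close>.\<close>
    then have "d (s y) (s a) < r"
      by (simp add: iso monoid_metricD(3)[OF d, of y a])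
    then have le: "d c (s y) + d (s y) (s a) \<le> u + u"
      using y(2) t(3) r(3) by (intro add_mono) auto
    have "d b (s a) \<le> d b c + d c (s a)"
      by (rule monoid_metricD(4)[OF d])
    also have "\<dots> \<le> d b c + (u + u)"
      using order_trans[OF monoid_metricD(4)[OF d] le] by (intro add_left_mono)
    finally show "s \<in> W d a b \<epsilon>"
      using u(2) s SIE by (auto simp: W_def dball_def)
  qed
  ultimately show ?thesis
    by (intro exI conjI)
qed

theorem theorem7p20:
  fixes d :: "'x \<Rightarrow> 'x \<Rightarrow> 'r::standard_distance_monoid"
    and S :: "('x \<Rightarrow> 'x) set"
    and T :: "'r set"
  assumes "monoid_metric d"
    and "submonoid_IE d S"
    and "closedin (mpw_topology d) S"
    and "submonoid_R T"
    and "order_dense T"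
    and "pinching d T S"
    and "spreading d T S"
  shows "(\<forall>a b. \<forall>\<epsilon>\<in>T - {0}. \<forall>s\<^sub>0\<in>S \<inter> W d a b \<epsilon>.
            \<exists>V. openin (zariski_topology S) V \<and> s\<^sub>0 \<in> V \<and> V \<subseteq> W d a b \<epsilon>)
       \<and> subtopology (mpw_topology d) S = zariski_topology S
       \<and> minimal_hausdorff_semigroup_topology S (subtopology (mpw_topology d) S)"
proof -
  let ?M = "subtopology (mpw_topology d) S" and ?Z = "zariski_topology S"
  have SIE: "S \<subseteq> IE d"
    using assms(2) by (simp add: submonoid_IE_def)
  \<comment> \<open>The threshold in the pinching condition provides a nonzero element.\<close>
  obtain e :: 'r where e: "e \<noteq> 0"
    using assms(6) unfolding pinching_def by blast
  have nbhd: "\<exists>V. openin ?Z V \<and> s\<^sub>0 \<in> V \<and> V \<subseteq> W d a b \<epsilon>"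
    if "s\<^sub>0 \<in> S" "s\<^sub>0 a \<in> dball d \<epsilon> b" for a b \<epsilon> s\<^sub>0
    using zariski_neighbourhood_in_W[OF assms(1) SIE assms(5-7) that] .
  have M: "hausdorff_semigroup_topology S ?M"
    using hausdorff_semigroup_mpw_topology[OF assms(1) e assms(2)] .
  \<comment> \<open>Each generating set of \<open>?M\<close> is a Zariski neighbourhood of each of
    its points.\<close>
  have "openin ?Z {s \<in> S. s a \<in> dball d \<epsilon> b}" for a b \<epsilon>
  proof (subst openin_subopen, intro ballI)
    fix s assume "s \<in> {s \<in> S. s a \<in> dball d \<epsilon> b}"
    then have "s \<in> S" "s a \<in> dball d \<epsilon> b"
      by simp_all
    then obtain V where V: "openin ?Z V" "s \<in> V" "V \<subseteq> W d a b \<epsilon>"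
      using nbhd[of s a \<epsilon> b] by auto
    moreover have "V \<subseteq> S"
      using openin_subset[OF V(1)] by (simp add: topspace_zariski_topology)
    ultimately show "\<exists>V. openin ?Z V \<and> s \<in> V \<and> V \<subseteq> {s \<in> S. s a \<in> dball d \<epsilon> b}"
      by (auto simp: W_def)
  qed
  then have "continuous_map ?Z ?M (\<lambda>s. s)"
    by (simp add: continuous_map_into_mpw_topology[OF assms(1) e SIE] topspace_zariski_topology)
  then have "openin ?Z U" if "openin ?M U" for U
  proof -
    have "openin ?Z {s \<in> topspace ?Z. s \<in> U}"
      using \<open>continuous_map ?Z ?M (\<lambda>s. s)\<close> that by (rule openin_continuous_map_preimage)
    moreover have "{s \<in> topspace ?Z. s \<in> U} = U"
      using openin_subset[OF that] by (auto simp: topspace_zariski_topology)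
    ultimately show ?thesis
      by simp
  qed
  then have eq: "?M = ?Z"
    using zariski_topology_coarsest[OF M] by (auto simp: topology_eq)
  have "minimal_hausdorff_semigroup_topology S ?M"
    unfolding minimal_hausdorff_semigroup_topology_def
  proof (intro conjI allI impI M)
    fix \<tau>' assume "hausdorff_semigroup_topology S \<tau>' \<and> (\<forall>U. openin \<tau>' U \<longrightarrow> openin ?M U)"
    \<comment> \<open>Such a topology also contains the Zariski topology, which equals
      \<open>?M\<close>, so both inclusions hold.\<close>
    then show "\<tau>' = ?M"
      using zariski_topology_coarsest[of S \<tau>'] unfolding topology_eq eq by blast
  qed
  moreover have "\<forall>a b. \<forall>\<epsilon>\<in>T - {0}. \<forall>s\<^sub>0\<in>S \<inter> W d a b \<epsilon>.
      \<exists>V. openin ?Z V \<and> s\<^sub>0 \<in> V \<and> V \<subseteq> W d a b \<epsilon>"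
    using nbhd by (simp add: W_def)
  ultimately show ?thesis
    using eq by blast
qed

end
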